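(* Let $X$ be a separable infinite-dimensional Banach space over $\mathbb{K}$ ($\mathbb{K}=\mathbb{R}$ or $\mathbb{C}$) and let $T \in \mathcal{B}(X)$ be such that $T \oplus T$ is frequently hypercyclic on $X \times X$. Then the set $$\{S \in \mathcal{B}(X) : T, S \text{ are d-frequently hypercyclic but do not satisfy the d-Hypercyclicity Criterion}\}$$ is dense in $\mathcal{B}(X)$ with respect to the strong operator topology.
   Context: $\mathbb{N}$ denotes the set of non-negative integers. $\mathcal{B}(Y)$ is the algebra of bounded linear operators on a Banach space $Y$. For $A \subset \mathbb{N}$, the lower density is $\underline{\mathrm{dens}}\, A := \liminf_{N\to\infty} \frac{\mathrm{card}\{n \le N : n \in A\}}{N}$. An operator $R \in \mathcal{B}(Y)$ is frequently hypercyclic if there is $y \in Y$ such that for every non-empty open $U \subset Y$ the set $\{n \in \mathbb{N} : R^n y \in U\}$ has positive lower density; such a $y$ is called a frequently hypercyclic vector for $R$. $T \oplus S$ is the operator $(x,y)\mapsto (Tx,Sy)$ on $X\times X$ (with the product topology). Operators $T,S\in\mathcal{B}(X)$ are d-frequently hypercyclic if there is $x \in X$ such that $(x,x)$ is a frequently hypercyclic vector for $T \oplus S$. d-Hypercyclicity Criterion: operators $T_1,\dots,T_N \in \mathcal{B}(X)$ satisfy the d-Hypercyclicity Criterion if there exist a strictly increasing sequence $(n_k)$ of positive integers, dense subsets $X_0,X_1,\dots,X_N$ of $X$, and mappings $S_{m,k}: X_m \to X$ ($1\le m\le N$, $k \in \mathbb{N}$; not assumed linear or continuous) such that for all $1\le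 m,i\le N$, as $k\to\infty$: (i) $T_m^{n_k}x \to 0$ for every $x \in X_0$; (ii) $S_{m,k}x \to 0$ for every $x\in X_m$; (iii) $T_m^{n_k}S_{i,k}x - \delta_{i,m}x \to 0$ for every $x \in X_i$, where $\delta_{i,m}$ is the Kronecker delta. *)

theory Defs
  imports "HOL-Analysis.Analysis"
begin

text \<open>Scalar fields that are \<open>\<real>\<close> or \<open>\<complex>\<close>. The norm needs no further
  axiom: the only multiplicative norm on \<open>\<complex>\<close> that extends the absolute value of \<open>\<real>\<close>
  is the usual modulus.\<close>

class real_or_complex_field = real_normed_field +
  assumes real_or_complex:
    "(\<forall>c. \<exists>a. c = a *\<^sub>R 1) \<or>
     (\<exists>i. i * i = - 1 \<and> (\<forall>c. \<exists>a b. c = a *\<^sub>R 1 + b *\<^sub>R i))"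

instance real :: real_or_complex_field
  by standard auto

instance complex :: real_or_complex_field
proof
  have "\<forall>c. \<exists>a b. c = a *\<^sub>R 1 + b *\<^sub>R \<i>"
    by (metis complex_eq mult.commute mult.right_neutral scaleR_conv_of_real)
  then show "(\<forall>c::complex. \<exists>a. c = a *\<^sub>R 1) \<or>
     (\<exists>i::complex. i * i = - 1 \<and> (\<forall>c. \<exists>a b. c = a *\<^sub>R 1 + b *\<^sub>R i))"
    by (intro disjI2 exI[of _ \<i>]) simp
qed

text \<open>The class \<^class>\<open>banach\<close> only provides real Banach spaces. A Banach space over \<open>'k\<close>
  is one with a scalar multiplication by \<open>'k\<close> that extends the real one and is compatible
  with the norm.\<close>

locale banach_space_over = vector_space scl
  for scl :: "'k::real_or_complex_field \<Rightarrow> 'a::banach \<Rightarrow> 'a" +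
  assumes scale_of_real: "scl (of_real r) x = r *\<^sub>R x"
    and norm_scale: "norm (scl c x) = norm c * norm x"

lemma banach_space_over_scaleR:
  "banach_space_over (scaleR :: real \<Rightarrow> 'a::banach \<Rightarrow> 'a)"
  by unfold_locales (auto simp: algebra_simps)

lemma banach_space_over_complex:
  "banach_space_over ((*) :: complex \<Rightarrow> complex \<Rightarrow> complex)"
  by unfold_locales (auto simp: algebra_simps norm_mult scaleR_conv_of_real)

definition infinite_dimensional ::
    "('k::real_or_complex_field \<Rightarrow> 'a::banach \<Rightarrow> 'a) \<Rightarrow> bool" where
  "infinite_dimensional scl \<longleftrightarrow> (\<nexists>B. finite B \<and> module.span scl B = UNIV)"

text \<open>Elements of the type \<open>'a \<Rightarrow>\<^sub>L 'a\<close> are only real linear; the bounded operators of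
  the space over \<open>'k\<close> are those that commute with all scalars.\<close>

definition bounded_operators ::
    "('k::real_or_complex_field \<Rightarrow> 'a::banach \<Rightarrow> 'a) \<Rightarrow> ('a \<Rightarrow>\<^sub>L 'a) set" where
  "bounded_operators scl = {T. \<forall>c x. blinfun_apply T (scl c x) = scl c (blinfun_apply T x)}"

definition lower_density :: "nat set \<Rightarrow> ereal" where
  "lower_density A = liminf (\<lambda>N. ereal (real (card {n. n \<le> N \<and> n \<in> A}) / real N))"

definition frequently_hypercyclic_vector :: "('b::banach \<Rightarrow>\<^sub>L 'b) \<Rightarrow> 'b \<Rightarrow> bool" where
  "frequently_hypercyclic_vector R y \<longleftrightarrow>
    (\<forall>U. open U \<and> U \<noteq> {} \<longrightarrow> lower_density {n. (blinfun_apply R ^^ n) y \<in> U} > 0)"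

definition frequently_hypercyclic :: "('b::banach \<Rightarrow>\<^sub>L 'b) \<Rightarrow> bool" where
  "frequently_hypercyclic R \<longleftrightarrow> (\<exists>y. frequently_hypercyclic_vector R y)"

definition direct_sum ::
    "('a::banach \<Rightarrow>\<^sub>L 'a) \<Rightarrow> ('a \<Rightarrow>\<^sub>L 'a) \<Rightarrow> ('a \<times> 'a) \<Rightarrow>\<^sub>L ('a \<times> 'a)" where
  "direct_sum T S = Blinfun (\<lambda>p. (blinfun_apply T (fst p), blinfun_apply S (snd p)))"

lemma direct_sum_apply:
  "blinfun_apply (direct_sum T S) (x, y) = (blinfun_apply T x, blinfun_apply S y)"
proof -
  have "bounded_linear (\<lambda>p. (blinfun_apply T (fst p), blinfun_apply S (snd p)))"
    by (intro bounded_linear_intros)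
  then show ?thesis
    by (simp add: direct_sum_def bounded_linear_Blinfun_apply)
qed

definition d_frequently_hypercyclic ::
    "('a::banach \<Rightarrow>\<^sub>L 'a) \<Rightarrow> ('a \<Rightarrow>\<^sub>L 'a) \<Rightarrow> bool" where
  "d_frequently_hypercyclic T S \<longleftrightarrow>
    (\<exists>x. frequently_hypercyclic_vector (direct_sum T S) (x, x))"

text \<open>The operator \<open>T\<^sub>m\<close> (\<open>1 \<le> m \<le> N\<close>) is the list entry \<open>Ts ! (m - 1)\<close>. The maps \<open>S m k\<close>
  are total functions of which only the values on \<open>X m\<close> matter.\<close>

definition d_hypercyclicity_criterion :: "('a::banach \<Rightarrow>\<^sub>L 'a) list \<Rightarrow> bool" where
  "d_hypercyclicity_criterion Ts \<longleftrightarrow>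
    (\<exists>(n :: nat \<Rightarrow> nat) (X :: nat \<Rightarrow> 'a set) (S :: nat \<Rightarrow> nat \<Rightarrow> 'a \<Rightarrow> 'a).
      strict_mono n \<and> (\<forall>k. n k > 0) \<and>
      (\<forall>m\<in>{0..length Ts}. closure (X m) = UNIV) \<and>
      (\<forall>m\<in>{1..length Ts}. \<forall>x\<in>X 0.
        (\<lambda>k. (blinfun_apply (Ts ! (m - 1)) ^^ n k) x) \<longlonglongrightarrow> 0) \<and>
      (\<forall>m\<in>{1..length Ts}. \<forall>x\<in>X m. (\<lambda>k. S m k x) \<longlonglongrightarrow> 0) \<and>
      (\<forall>m\<in>{1..length Ts}. \<forall>i\<in>{1..length Ts}. \<forall>x\<in>X i.
        (\<lambda>k. (blinfun_apply (Ts ! (m - 1)) ^^ n k) (S i k x) - (if i = m then x else 0))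
          \<longlonglongrightarrow> 0))"

end

theory Submission
  imports Defs
begin

text \<open>Let \<open>(u, v)\<close> be a frequently hypercyclic vector for \<open>T \<oplus> T\<close> and \<open>L\<close> an isomorphism of
  \<open>X\<close> with \<open>L u = v\<close>. Then \<open>I \<oplus> L\<close> conjugates \<open>T \<oplus> S\<close>, where \<open>S = L\<^sup>-\<^sup>1 T L\<close>, to \<open>T \<oplus> T\<close> and
  maps \<open>(u, u)\<close> to \<open>(u, v)\<close>, so \<open>T, S\<close> are d-frequently hypercyclic. If moreover \<open>L - I\<close> has
  finite rank, then at each time the \<open>T\<close>-orbits of \<open>w\<close> and \<open>L w\<close> differ, for all \<open>w\<close>, only by vectors
  in a space whose dimension is at most that rank, which is incompatible with the d-Hypercyclicity Criterion.
  Finally \<open>L\<close> may be prescribed on finitely many independent vectors, with independent values;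
  values taken from the orbit of \<open>u\<close> let \<open>S\<close> approximate any operator on a finite set.\<close>

subsection \<open>The Hahn-Banach theorem\<close>

text \<open>Homogeneity is required only as an inequality, which passes directly to infima; equality
  follows by rescaling with \<open>1 / t\<close>.\<close>

definition sublinear :: "('a::real_vector \<Rightarrow> real) \<Rightarrow> bool" where
  "sublinear q \<longleftrightarrow> (\<forall>x y. q (x + y) \<le> q x + q y) \<and> (\<forall>t x. 0 \<le> t \<longrightarrow> q (t *\<^sub>R x) \<le> t * q x)"

lemma sublinear_add: "sublinear q \<Longrightarrow> q (x + y) \<le> q x + q y"
  and sublinear_scaleR_le: "sublinear q \<Longrightarrow> 0 \<le> t \<Longrightarrow> q (t *\<^sub>R x) \<le> t * q x"
  unfolding sublinear_def by auto

lemma sublinear_zero: "sublinear q \<Longrightarrow> q 0 = 0"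
  using sublinear_add[of q 0 0] sublinear_scaleR_le[of q 0 0] by simp

lemma sublinear_minus: "sublinear q \<Longrightarrow> - q (- x) \<le> q x"
  using sublinear_add[of q x "- x"] sublinear_zero[of q] by simp

lemma sublinear_scaleR:
  assumes "sublinear q" "0 \<le> t" shows "q (t *\<^sub>R x) = t * q x"
proof (cases "t = 0")
  case False
  then have "t > 0" using assms by simp
  have "q ((1 / t) *\<^sub>R (t *\<^sub>R x)) \<le> (1 / t) * q (t *\<^sub>R x)"
    using assms by (intro sublinear_scaleR_le) simp_all
  then have "t * q x \<le> q (t *\<^sub>R x)" using \<open>t > 0\<close> by (simp add: field_simps)
  then show ?thesis using sublinear_scaleR_le[OF assms, of x] by simp
qed (use sublinear_zero assms in auto)

text \<open>Given two members \<open>q\<close> and \<open>r\<close> of the chain, the smaller one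
  serves as a common bound in the subadditivity estimate. Infima over \<open>q\<close> and
  \<open>r\<close> can then be taken separately.\<close>

lemma sublinear_Inf_chain:
  assumes ne: "C \<noteq> {}" and sub: "\<And>q. q \<in> C \<Longrightarrow> sublinear q"
    and total: "\<And>q r. q \<in> C \<Longrightarrow> r \<in> C \<Longrightarrow> q \<le> r \<or> r \<le> q"
    and bdd: "\<And>x. bdd_below ((\<lambda>q. q x) ` C)"
  shows "sublinear (\<lambda>x. INF q\<in>C. q x)"
  unfolding sublinear_def
proof (intro conjI allI impI)
  let ?I = "\<lambda>x. INF q\<in>C. q x"
  have lower: "?I x \<le> q x" if "q \<in> C" for q x
    using bdd that by (rule cINF_lower)
  fix x y
  have "?I (x + y) \<le> q x + r y" if "q \<in> C" "r \<in> C" for q r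
  proof -
    from total[OF that] have "\<exists>s\<in>C. s \<le> q \<and> s \<le> r" using that by auto
    then obtain s where "s \<in> C" "s \<le> q" "s \<le> r" by blast
    then show ?thesis
      using lower[OF \<open>s \<in> C\<close>, of "x + y"] sublinear_add[OF sub[OF \<open>s \<in> C\<close>], of x y]
        le_funD[OF \<open>s \<le> q\<close>, of x] le_funD[OF \<open>s \<le> r\<close>, of y] by linarith
  qed
  then have "?I (x + y) - q x \<le> r y" if "q \<in> C" "r \<in> C" for q r
    using that by (simp add: diff_le_eq add.commute)
  then have "?I (x + y) - q x \<le> ?I y" if "q \<in> C" for q
    using cINF_greatest[OF ne, of "?I (x + y) - q x" "\<lambda>r. r y"] that by blast
  then have "?I (x + y) - ?I y \<le> q x" if "q \<in> C" for q
    using that by (simp add: diff_le_eq add.commute)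
  then have "?I (x + y) - ?I y \<le> ?I x"
    using cINF_greatest[OF ne, of "?I (x + y) - ?I y" "\<lambda>q. q x"] by blast
  then show "?I (x + y) \<le> ?I x + ?I y" by simp
next
  let ?I = "\<lambda>x. INF q\<in>C. q x"
  have lower: "?I x \<le> q x" if "q \<in> C" for q x
    using bdd that by (rule cINF_lower)
  fix t :: real and x assume t: "0 \<le> t"
  show "?I (t *\<^sub>R x) \<le> t * ?I x"
  proof (cases "t = 0")
    case True
    then have "?I (t *\<^sub>R x) = (INF q\<in>C. 0)"
      using sublinear_zero[OF sub] by (intro arg_cong[where f = Inf] image_cong) auto
    then show ?thesis using True ne by simp
  next
    case False
    then have "t > 0" using t by simp
    have "?I (t *\<^sub>R x) / t \<le> ?I x"
      using ne
    proof (rule cINF_greatest)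
      fix q assume "q \<in> C"
      show "?I (t *\<^sub>R x) / t \<le> q x"
        using lower[OF \<open>q \<in> C\<close>, of "t *\<^sub>R x"] sublinear_scaleR_le[OF sub[OF \<open>q \<in> C\<close>] t, of x]
          \<open>t > 0\<close> by (simp add: field_simps)
    qed
    then show ?thesis using \<open>t > 0\<close> by (simp add: field_simps)
  qed
qed

text \<open>Lowering \<open>q\<close> along \<open>v\<close> gives a sublinear functional \<open>r \<le> q\<close> with \<open>r x \<le> q (x + v) - q v\<close>;
  a minimal \<open>q\<close> must coincide with \<open>r\<close> and is therefore additive.\<close>

lemma sublinear_lower_along:
  assumes q: "sublinear q"
  obtains r where "sublinear r" "r \<le> q" "\<And>x. r x \<le> q (x + v) - q v"
proof
  define F where "F = (\<lambda>x t. q (x + t *\<^sub>R v) - t * q v)"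
  define r where "r = (\<lambda>x. INF t\<in>{0..}. F x t)"
  \<comment> \<open>Subadditivity applied to \<open>x + t *\<^sub>R v\<close> and \<open>- x\<close>
    bounds the family from below, so the infimum \<open>r x\<close> is a genuine one.\<close>
  have "- q (- x) \<le> F x t" if "0 \<le> t" for x t
    using sublinear_add[OF q, of "x + t *\<^sub>R v" "- x"] sublinear_scaleR[OF q that, of v]
    by (simp add: F_def)
  then have "bdd_below (F x ` {0..})" for x by (intro bdd_belowI2) auto
  then have lower: "r x \<le> F x t" if "0 \<le> t" for x t
    unfolding r_def using that by (intro cINF_lower) auto
  have greatest: "c \<le> r x" if "\<And>t. 0 \<le> t \<Longrightarrow> c \<le> F x t" for c x
    unfolding r_def using that by (intro cINF_greatest) auto
  show le: "r \<le> q" using lower[of 0] by (auto simp: F_def le_fun_def)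
  show "r x \<le> q (x + v) - q v" for x using lower[of 1 x] by (simp add: F_def)
  show "sublinear r"
    unfolding sublinear_def
  proof (intro conjI allI impI)
    fix x y
    have F_add: "F (x + y) (s + t) \<le> F x s + F y t" for s t
      using sublinear_add[OF q, of "x + s *\<^sub>R v" "y + t *\<^sub>R v"]
      by (simp add: F_def algebra_simps)
    have "r (x + y) - F x s \<le> r y" if "0 \<le> s" for s
      by (rule greatest)
        (use that lower[of "s + _" "x + y"] F_add in \<open>smt (verit)\<close>)
    then have "r (x + y) - r y \<le> r x"
      by (intro greatest) (smt (verit))
    then show "r (x + y) \<le> r x + r y" by simp
  next
    fix t :: real and x assume "0 \<le> t"
    show "r (t *\<^sub>R x) \<le> t * r x"
    proof (cases "t = 0")
      case True
      then show ?thesis using le sublinear_zero[OF q] by (auto simp: le_fun_def dest: spec[of _ 0])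
    next
      case False
      then have t: "t > 0" using \<open>0 \<le> t\<close> by simp
      have "r (t *\<^sub>R x) / t \<le> r x"
      proof (rule greatest)
        fix s :: real assume "0 \<le> s"
        have "r (t *\<^sub>R x) \<le> F (t *\<^sub>R x) (t * s)" using t \<open>0 \<le> s\<close> by (intro lower) simp
        also have "\<dots> = t * F x s"
          using sublinear_scaleR[OF q \<open>0 \<le> t\<close>, of "x + s *\<^sub>R v"] by (simp add: F_def algebra_simps)
        finally show "r (t *\<^sub>R x) / t \<le> F x s" using t by (simp add: field_simps)
      qed
      then show ?thesis using t by (simp add: field_simps)
    qed
  qed
qed

lemma linear_below_sublinear:
  fixes p :: "'a::real_vector \<Rightarrow> real"
  assumes p: "sublinear p"
  obtains f where "linear f" "f \<le> p" "f e = p e"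
proof -
  \<comment> \<open>Lowering \<open>p\<close> along \<open>e\<close> first gives
    \<open>p' (- e) \<le> - p e\<close>. A linear functional below \<open>p'\<close> is then at
    least \<open>p e\<close> at \<open>e\<close>.\<close>
  obtain p' where p': "sublinear p'" "p' \<le> p" "\<And>x. p' x \<le> p (x + e) - p e"
    using sublinear_lower_along[OF p, of e] by blast
  let ?A = "{q. sublinear q \<and> q \<le> p'}"
  \<comment> \<open>Zorn's lemma is applied to the reversed order, so a minimal element results and
    chains need lower bounds.\<close>
  have "\<exists>m\<in>?A. \<forall>a\<in>?A. a \<le> m \<longrightarrow> a = m"
  proof (rule predicate_Zorn)
    show "partial_order_on ?A (relation_of (\<lambda>a b. b \<le> a) ?A)"
      by (rule partial_order_on_relation_ofI) auto
    fix C assume C: "C \<in> Chains (relation_of (\<lambda>a b. b \<le> a) ?A)"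
    then have sub: "C \<subseteq> ?A" and total: "\<And>q r. q \<in> C \<Longrightarrow> r \<in> C \<Longrightarrow> q \<le> r \<or> r \<le> q"
      unfolding Chains_def relation_of_def by blast+
    show "\<exists>u\<in>?A. \<forall>a\<in>C. u \<le> a"
    proof (cases "C = {}")
      case True
      then show ?thesis using p' by auto
    next
      case False
      have bdd: "bdd_below ((\<lambda>q. q x) ` C)" for x
      proof (rule bdd_belowI2)
        fix q assume "q \<in> C"
        then have "sublinear q" "q (- x) \<le> p' (- x)" using sub by (auto simp: le_fun_def)
        then show "- p' (- x) \<le> q x" using sublinear_minus[of q x] by linarith
      qed
      have lower: "(\<lambda>x. INF q\<in>C. q x) \<le> a" if "a \<in> C" for a
        unfolding le_fun_def using bdd that by (auto intro: cINF_lower)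
      obtain c where "c \<in> C" using False by blast
      with sub lower have "(\<lambda>x. INF q\<in>C. q x) \<le> p'" by (blast intro: order_trans)
      moreover have "sublinear (\<lambda>x. INF q\<in>C. q x)"
        using False sub total bdd by (intro sublinear_Inf_chain) blast+
      ultimately show ?thesis using lower by blast
    qed
  qed
  then obtain m where m: "sublinear m" "m \<le> p'"
    and minimal: "\<And>a. sublinear a \<Longrightarrow> a \<le> p' \<Longrightarrow> a \<le> m \<Longrightarrow> a = m"
    by blast
  have add: "m (x + v) = m x + m v" for x v
  proof -
    obtain r where "sublinear r" "r \<le> m" "\<And>x. r x \<le> m (x + v) - m v"
      using sublinear_lower_along[OF m(1), of v] by blast
    moreover from this have "r = m" using m by (intro minimal) auto
    ultimately have "m x \<le> m (x + v) - m v" by blast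
    then show ?thesis using sublinear_add[OF m(1), of x v] by linarith
  qed
  have neg: "m (- x) = - m x" for x
    using add[of x "- x"] sublinear_zero[OF m(1)] by simp
  have "linear m"
  proof (rule linearI)
    fix t x
    show "m (t *\<^sub>R x) = t *\<^sub>R m x"
    proof (cases "0 \<le> t")
      case False
      then have "m ((- t) *\<^sub>R x) = - t * m x" by (intro sublinear_scaleR[OF m(1)]) simp
      then show ?thesis using neg[of "t *\<^sub>R x"] by simp
    qed (simp add: sublinear_scaleR[OF m(1)])
  qed (rule add)
  moreover have "m \<le> p" using m(2) p'(2) by (rule order_trans)
  moreover have "p e \<le> m e"
    using le_funD[OF m(2), of "- e"] p'(3)[of "- e"] neg[of e] sublinear_zero[OF p] by simp
  ultimately show thesis using that le_funD[of m p e] by (metis order_antisym)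
qed

text \<open>This is the majorant for the separation theorem: a linear functional below the distance
  to \<open>M\<close> vanishes on \<open>M\<close> and is bounded by the norm.\<close>

lemma sublinear_infdist:
  fixes M :: "'a::real_normed_vector set"
  assumes M: "subspace M"
  shows "sublinear (\<lambda>x. infdist x M)"
  unfolding sublinear_def
proof (intro conjI allI impI)
  have ne: "M \<noteq> {}" using subspace_0[OF M] by blast
  have approx: "\<exists>a\<in>M. dist x a < infdist x M + e" if "e > 0" for x e
    using that cINF_less_iff[OF ne bdd_below_image_dist, of x "infdist x M + e"]
    by (simp add: infdist_notempty[OF ne, symmetric])
  fix x y
  show "infdist (x + y) M \<le> infdist x M + infdist y M"
  proof (rule field_le_epsilon)
    fix e :: real assume "e > 0"
    obtain a b where ab: "a \<in> M" "dist x a < infdist x M + e / 2" "b \<in> M" "dist y b < infdist y M + e / 2"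
      using approx[of "e / 2"] \<open>e > 0\<close> by (meson half_gt_zero)
    have "infdist (x + y) M \<le> dist (x + y) (a + b)"
      using ab subspace_add[OF M] by (intro infdist_le) auto
    also have "\<dots> \<le> dist x a + dist y b" by (rule dist_triangle_add)
    finally show "infdist (x + y) M \<le> infdist x M + infdist y M + e" using ab by simp
  qed
next
  have ne: "M \<noteq> {}" using subspace_0[OF M] by blast
  fix t :: real and x assume "0 \<le> t"
  show "infdist (t *\<^sub>R x) M \<le> t * infdist x M"
  proof (cases "t = 0")
    case True
    then show ?thesis using subspace_0[OF M] by simp
  next
    case False
    then have t: "t > 0" using \<open>0 \<le> t\<close> by simp
    have "infdist (t *\<^sub>R x) M / t \<le> dist x a" if "a \<in> M" for a
    proof -
      have "infdist (t *\<^sub>R x) M \<le> dist (t *\<^sub>R x) (t *\<^sub>R a)"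
        using that subspace_scale[OF M] by (intro infdist_le) auto
      also have "\<dots> = t * dist x a"
        using t by (simp add: dist_norm flip: scaleR_diff_right)
      finally show ?thesis using t by (simp add: field_simps)
    qed
    then have "infdist (t *\<^sub>R x) M / t \<le> infdist x M"
      unfolding infdist_notempty[OF ne, of x] using ne by (intro cINF_greatest)
    then show ?thesis using t by (simp add: field_simps)
  qed
qed

lemma Hahn_Banach_closed_subspace:
  fixes M :: "'a::real_normed_vector set"
  assumes M: "subspace M" "closed M" and e: "e \<notin> M"
  obtains f :: "'a \<Rightarrow> real" where "bounded_linear f" "\<And>x. x \<in> M \<Longrightarrow> f x = 0" "f e > 0"
proof -
  have ne: "M \<noteq> {}" using subspace_0[OF M(1)] by blast
  obtain f where f: "linear f" "f \<le> (\<lambda>x. infdist x M)" "f e = infdist e M"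
    using linear_below_sublinear[OF sublinear_infdist[OF M(1)], of e] by blast
  have le: "f x \<le> infdist x M" for x using f(2) by (simp add: le_fun_def)
  have "infdist x M \<le> norm x" for x
    using infdist_le[OF subspace_0[OF M(1)], of x] by simp
  then have "norm (f x) \<le> norm x * 1" for x
    using le[of x] le[of "- x"] linear_neg[OF f(1), of x]
    by (smt (verit) norm_minus_cancel real_norm_def)
  then have "bounded_linear f"
    using f(1) by (intro bounded_linear_intro[where K = 1]) (auto simp: linear_add linear_scale)
  moreover have "f x = 0" if "x \<in> M" for x
    using le[of x] le[of "- x"] linear_neg[OF f(1), of x] that subspace_neg[OF M(1) that]
    by simp
  moreover have "f e > 0"
    using f(3) M(2) ne e in_closed_iff_infdist_zero[of M e] infdist_nonneg[of e M] by auto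
  ultimately show thesis using that by blast
qed

section \<open>Bounded functionals over the scalar field and finite-dimensional subspaces\<close>

context banach_space_over
begin

text \<open>Since \<open>bounded_linear\<close> refers to real scalars, homogeneity over
  \<open>'k\<close> is imposed separately.\<close>

definition bounded_functional :: "('a \<Rightarrow> 'k) \<Rightarrow> bool" where
  "bounded_functional g \<longleftrightarrow> bounded_linear g \<and> (\<forall>c x. g (scl c x) = c * g x)"

definition bounded_operator :: "('a \<Rightarrow> 'a) \<Rightarrow> bool" where
  "bounded_operator f \<longleftrightarrow> bounded_linear f \<and> (\<forall>c x. f (scl c x) = scl c (f x))"

lemma bounded_bilinear_scl: "bounded_bilinear scl"
proof
  fix r :: real and a b
  show "scl (r *\<^sub>R a) b = r *\<^sub>R scl a b"
    by (metis scale_of_real scale_scale scaleR_conv_of_real)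
  show "scl a (r *\<^sub>R b) = r *\<^sub>R scl a b"
    by (metis scale_of_real scale_left_commute)
  show "\<exists>K. \<forall>a b. norm (scl a b) \<le> norm a * norm b * K"
    by (rule exI[of _ 1]) (simp add: norm_scale)
qed (simp_all add: scale_left_distrib scale_right_distrib)

lemma subspace_imp_real_subspace: "subspace M \<Longrightarrow> Real_Vector_Spaces.subspace M"
  unfolding Real_Vector_Spaces.subspace_def subspace_def by (metis scale_of_real)

lemma bounded_linear_scl_right: "bounded_linear (scl c)"
  by (rule bounded_bilinear.bounded_linear_right[OF bounded_bilinear_scl])

text \<open>Over the reals the real functional \<open>f\<close> is used as it is. In the complex
  case it is complexified to \<open>f x - i f (i x)\<close>, which still vanishes on
  \<open>M\<close> because \<open>M\<close> is invariant under \<open>i\<close>.\<close>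

lemma Hahn_Banach_functional:
  assumes M: "subspace M" "closed M" and e: "e \<notin> M"
  obtains g where "bounded_functional g" "\<And>x. x \<in> M \<Longrightarrow> g x = 0" "g e \<noteq> 0"
proof -
  obtain f :: "'a \<Rightarrow> real" where f: "bounded_linear f" "\<And>x. x \<in> M \<Longrightarrow> f x = 0" "f e > 0"
    using Hahn_Banach_closed_subspace[OF subspace_imp_real_subspace[OF M(1)] M(2) e] by blast
  interpret f: bounded_linear f by fact
  have bl: "bounded_linear (\<lambda>x. of_real (f x) :: 'k)"
    by (rule bounded_linear_compose[OF bounded_linear_of_real f(1)])
  from real_or_complex[where 'a = 'k] show thesis
  proof
    assume real: "\<forall>c::'k. \<exists>a. c = a *\<^sub>R 1"
    have "bounded_functional (\<lambda>x. of_real (f x))"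
      unfolding bounded_functional_def
    proof (intro conjI allI)
      fix c :: 'k and x
      obtain a where "c = a *\<^sub>R 1" using real by blast
      then show "of_real (f (scl c x)) = c * of_real (f x)"
        by (simp add: scale_of_real f.scaleR flip: of_real_def)
    qed (rule bl)
    then show thesis using f by (intro that[of "\<lambda>x. of_real (f x)"]) auto
  next
    assume "\<exists>i::'k. i * i = - 1 \<and> (\<forall>c. \<exists>a b. c = a *\<^sub>R 1 + b *\<^sub>R i)"
    then obtain i :: 'k where i: "i * i = - 1" and cplx: "\<And>c. \<exists>a b. c = a *\<^sub>R 1 + b *\<^sub>R i"
      by blast
    define g where "g = (\<lambda>x. of_real (f x) - i * of_real (f (scl i x)))"
    have blg: "bounded_linear g"
      unfolding g_def
      by (intro bounded_linear_sub bl bounded_linear_const_mult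
          bounded_linear_compose[OF bl bounded_linear_scl_right])
    interpret g: bounded_linear g by fact
    have g_i: "g (scl i x) = i * g x" for x
    proof -
      have "scl i (scl i x) = - x" by (simp add: i)
      then have "g (scl i x) = of_real (f (scl i x)) + i * of_real (f x)"
        by (simp add: g_def f.neg)
      also have "\<dots> = i * of_real (f x) - (i * i) * of_real (f (scl i x))" by (simp add: i)
      finally show ?thesis by (simp add: g_def algebra_simps)
    qed
    have "g (scl c x) = c * g x" for c x
    proof -
      obtain a b where c: "c = of_real a + of_real b * i"
        using cplx[of c] by (auto simp: scaleR_conv_of_real)
      have "scl c x = a *\<^sub>R x + b *\<^sub>R scl i x"
        by (simp add: c scale_left_distrib scale_of_real flip: scale_scale)
      then show ?thesis
        by (simp add: g.add g.scaleR g_i c scaleR_conv_of_real algebra_simps)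
    qed
    then have "bounded_functional g" using blg by (simp add: bounded_functional_def)
    moreover have "g x = 0" if "x \<in> M" for x
      using f(2)[OF that] f(2)[of "scl i x"] M(1) that by (simp add: g_def subspace_scale)
    moreover have "g e \<noteq> 0"
    proof
      assume "g e = 0"
      \<comment> \<open>Squaring replaces the comparison of real and imaginary parts: a positive
        square would equal minus a square.\<close>
      then have eq: "of_real (f e) = i * of_real (f (scl i e))" by (simp add: g_def)
      have "of_real (f e * f e) = (i * i) * (of_real (f (scl i e) * f (scl i e)))"
        by (simp add: eq)
      also have "\<dots> = of_real (- (f (scl i e) * f (scl i e)))" by (simp add: i)
      finally have "f e * f e = - (f (scl i e) * f (scl i e))"
        unfolding of_real_eq_iff .
      then show False using f(3) by (smt (verit) mult_pos_pos zero_le_square)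
    qed
    ultimately show thesis by (rule that)
  qed
qed

text \<open>In the induction a functional \<open>g\<close> vanishing on \<open>span B\<close> but
  not at \<open>b\<close> recovers the coefficient of \<open>b\<close> continuously, which exhibits
  the larger span as a preimage of \<open>span B\<close>.\<close>

lemma closed_span_finite: "finite B \<Longrightarrow> closed (span B)"
proof (induction rule: finite_induct)
  case (insert b B)
  show ?case
  proof (cases "b \<in> span B")
    case True
    then show ?thesis using insert by (simp add: span_redundant)
  next
    case False
    obtain g where g: "bounded_functional g" "\<And>x. x \<in> span B \<Longrightarrow> g x = 0" "g b \<noteq> 0"
      using Hahn_Banach_functional[OF subspace_span insert.IH False] by blast
    then interpret g: bounded_linear g by (simp add: bounded_functional_def)
    let ?h = "\<lambda>x. x - scl (g x / g b) b"
    have eq: "span (insert b B) = ?h -` span B"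
    proof (intro set_eqI iffI)
      fix x assume "x \<in> span (insert b B)"
      then obtain k where k: "x - scl k b \<in> span B" by (auto simp: span_breakdown_eq)
      then have "g x = k * g b"
        using g(1) g(2)[OF k] by (simp add: g.diff bounded_functional_def)
      then show "x \<in> ?h -` span B" using k g(3) by simp
    qed (auto simp: span_breakdown_eq)
    have "bounded_linear (\<lambda>x. scl (g x / g b) b)"
      using bounded_linear_compose[OF bounded_bilinear.bounded_linear_left[OF bounded_bilinear_scl]
          bounded_linear_compose[OF bounded_linear_divide g.bounded_linear_axioms]] .
    then have "continuous_on UNIV ?h"
      by (intro continuous_intros linear_continuous_on)
    then show ?thesis
      unfolding eq using insert.IH by (intro closed_vimage) auto
  qed
qed simp

text \<open>Take \<open>g\<close> nonzero at \<open>a\<close> and \<open>h\<close> nonzero at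
  \<open>b\<close>. If neither serves both points, then \<open>g b = 0\<close> and
  \<open>h a = 0\<close>, and \<open>g + h\<close> does.\<close>

lemma functional_vanishing_on_span:
  assumes "finite B" "a \<notin> span B" "b \<notin> span B"
  obtains g where "bounded_functional g" "\<And>x. x \<in> span B \<Longrightarrow> g x = 0" "g a \<noteq> 0" "g b \<noteq> 0"
proof -
  note HB = Hahn_Banach_functional[OF subspace_span closed_span_finite[OF assms(1)]]
  obtain g where g: "bounded_functional g" "\<And>x. x \<in> span B \<Longrightarrow> g x = 0" "g a \<noteq> 0"
    using HB[OF assms(2)] by blast
  obtain h where h: "bounded_functional h" "\<And>x. x \<in> span B \<Longrightarrow> h x = 0" "h b \<noteq> 0"
    using HB[OF assms(3)] by blast
  have "bounded_functional (\<lambda>x. g x + h x)"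
    using g(1) h(1) by (auto simp: bounded_functional_def bounded_linear_add algebra_simps)
  then show thesis
    using that[of g] that[of h] that[of "\<lambda>x. g x + h x"] g h by force
qed

subsection \<open>Finite rank perturbations of the identity\<close>

text \<open>The inverse is part of the data, so that its boundedness needs no open mapping theorem.\<close>

definition finite_rank_perturbation :: "('a \<Rightarrow> 'a) \<Rightarrow> ('a \<Rightarrow> 'a) \<Rightarrow> bool" where
  "finite_rank_perturbation L M \<longleftrightarrow> bounded_operator L \<and> bounded_operator M \<and>
    (\<forall>x. L (M x) = x) \<and> (\<forall>x. M (L x) = x) \<and> (\<exists>G. finite G \<and> (\<forall>x. L x - x \<in> span G))"

lemma finite_rank_perturbation_compose:
  assumes "finite_rank_perturbation L M" "finite_rank_perturbation L' M'"
  shows "finite_rank_perturbation (\<lambda>x. L' (L x)) (\<lambda>x. M (M' x))"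
proof -
  from assms obtain G G' where G: "finite G" "\<And>x. L x - x \<in> span G"
    and G': "finite G'" "\<And>x. L' x - x \<in> span G'"
    unfolding finite_rank_perturbation_def by blast
  have "L' (L x) - x \<in> span (G \<union> G')" for x
  proof -
    have "(L' (L x) - L x) + (L x - x) \<in> span (G \<union> G')"
      using G(2) G'(2) span_mono[of G "G \<union> G'"] span_mono[of G' "G \<union> G'"]
      by (intro span_add) blast+
    then show ?thesis by simp
  qed
  moreover have "finite (G \<union> G')" using G G' by simp
  ultimately have "\<exists>H. finite H \<and> (\<forall>x. L' (L x) - x \<in> span H)" by blast
  then show ?thesis
    using assms unfolding finite_rank_perturbation_def bounded_operator_def
    by (auto intro: bounded_linear_compose[of L' L] bounded_linear_compose[of M M'])
qed

text \<open>The first map sends \<open>a\<close> to \<open>b\<close> and fixes the kernel of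
  \<open>g\<close>. It multiplies \<open>g\<close> by the nonzero factor \<open>g b / g a\<close>,
  and so the second formula inverts it.\<close>

lemma finite_rank_perturbation_transvection:
  assumes g: "bounded_functional g" "g a \<noteq> 0" "g b \<noteq> 0"
  shows "finite_rank_perturbation (\<lambda>x. x + scl (g x / g a) (b - a)) (\<lambda>x. x - scl (g x / g b) (b - a))"
    (is "finite_rank_perturbation ?L ?M")
proof -
  interpret g: bounded_linear g using g by (simp add: bounded_functional_def)
  have g_scl: "g (scl c x) = c * g x" for c x using g by (simp add: bounded_functional_def)
  have bl: "bounded_linear (\<lambda>x. scl (g x / c) v)" for c v
    using bounded_linear_compose[OF bounded_bilinear.bounded_linear_left[OF bounded_bilinear_scl]
          bounded_linear_compose[OF bounded_linear_divide g.bounded_linear_axioms]] .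
  have gL: "g (?L x) = g x * g b / g a" for x
    using g by (simp add: g.add g.diff g_scl field_simps)
  have gM: "g (?M x) = g x * g a / g b" for x
  proof -
    have "g (?M x) = g x - g x / g b * (g b - g a)" by (simp only: g.diff g_scl)
    then show ?thesis using g by (simp add: field_simps)
  qed
  have "?L x - x \<in> span {b - a}" for x
    by (simp add: span_scale span_base)
  then have "\<exists>G. finite G \<and> (\<forall>x. ?L x - x \<in> span G)" by blast
  moreover have "bounded_operator ?L" "bounded_operator ?M"
    using bl unfolding bounded_operator_def
    by (auto intro!: bounded_linear_add bounded_linear_sub bounded_linear_ident
        simp: g_scl scale_right_distrib scale_right_diff_distrib)
  moreover have "?M (?L x) = x" "?L (?M x) = x" for x
    using gL[of x] gM[of x] g by simp_all
  ultimately show ?thesis by (simp add: finite_rank_perturbation_def)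
qed

lemma finite_rank_perturbation_id: "finite_rank_perturbation (\<lambda>x. x) (\<lambda>x. x)"
  by (auto simp: finite_rank_perturbation_def bounded_operator_def bounded_linear_ident)

lemma bounded_operator_linear:
  assumes "bounded_operator f" shows "Vector_Spaces.linear scl scl f"
proof -
  interpret f: bounded_linear f using assms by (simp add: bounded_operator_def)
  show ?thesis
    using assms by unfold_locales (auto simp: bounded_operator_def f.add)
qed

lemma bounded_operator_span_image:
  "bounded_operator f \<Longrightarrow> span (f ` G) = f ` span G"
proof -
  interpret vector_space_pair scl scl ..
  show "bounded_operator f \<Longrightarrow> span (f ` G) = f ` span G"
    using linear_span_image bounded_operator_linear by blast
qed

text \<open>Interpolation: the vectors are moved to their targets one at a time, by transvections
  that fix the targets already reached.\<close>

lemma finite_rank_perturbation_interpolation: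
  assumes "length us = length vs" "distinct us" "distinct vs" "independent (set us)" "independent (set vs)"
  shows "\<exists>L M. finite_rank_perturbation L M \<and> map L us = vs"
  using assms
proof (induction us vs rule: list_induct2)
  case Nil
  then show ?case using finite_rank_perturbation_id by auto
next
  case (Cons a us b vs)
  then have ind: "independent (set us)" "independent (set vs)"
    and a: "a \<notin> span (set us)" and b: "b \<notin> span (set vs)"
    by (auto simp: independent_insert)
  with Cons obtain L M where L: "finite_rank_perturbation L M" "map L us = vs" by auto
  have bop: "bounded_operator L" and inv: "\<And>x. M (L x) = x"
    using L(1) by (auto simp: finite_rank_perturbation_def)
  have "span (set vs) = L ` span (set us)"
    using bounded_operator_span_image[OF bop, of "set us"] L(2) by (metis list.set_map)
  \<comment> \<open>Injectivity of \<open>L\<close> keeps the image of \<open>a\<close> outside the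
    image of \<open>span (set us)\<close>.\<close>
  then have "L a \<notin> span (set vs)" using a inv by (metis image_iff)
  then obtain g where g: "bounded_functional g" "\<And>x. x \<in> span (set vs) \<Longrightarrow> g x = 0"
    "g (L a) \<noteq> 0" "g b \<noteq> 0"
    using functional_vanishing_on_span[of "set vs" "L a" b] b by auto
  define L' where "L' = (\<lambda>x. x + scl (g x / g (L a)) (b - L a))"
  obtain M' where L': "finite_rank_perturbation L' M'"
    using finite_rank_perturbation_transvection[OF g(1,3,4)] by (auto simp: L'_def)
  have "L' (L a) = b" using g by (simp add: L'_def)
  moreover have "L' x = x" if "x \<in> set vs" for x using g(2)[OF span_base[OF that]] by (simp add: L'_def)
  then have "map L' vs = vs" by (rule map_idI)
  then have "map (\<lambda>x. L' (L x)) us = vs"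
    unfolding L(2)[symmetric] by (simp add: comp_def)
  ultimately have "map (\<lambda>x. L' (L x)) (a # us) = b # vs" by simp
  then show ?case
    using finite_rank_perturbation_compose[OF L(1) L'] by (intro exI conjI)
qed

end

subsection \<open>Frequently hypercyclic vectors\<close>

lemma direct_sum_power:
  "(blinfun_apply (direct_sum T S) ^^ n) (x, y) = ((blinfun_apply T ^^ n) x, (blinfun_apply S ^^ n) y)"
  by (induction n) (simp_all add: direct_sum_apply)

lemma bounded_linear_blinfun_power:
  fixes T :: "'b::real_normed_vector \<Rightarrow>\<^sub>L 'b"
  shows "bounded_linear (blinfun_apply T ^^ n)"
proof (induction n)
  case 0
  then show ?case by (simp only: funpow.simps id_def bounded_linear_ident)
next
  case (Suc n)
  then show ?case
    using bounded_linear_compose[OF blinfun.bounded_linear_right] by (simp add: comp_def)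
qed

lemma positive_lower_density_imp_infinite:
  assumes "lower_density A > 0" shows "infinite A"
proof
  assume "finite A"
  have "(\<lambda>N. ereal (real (card A) / real N)) \<longlonglongrightarrow> ereal 0"
    using lim_const_over_n[of "real (card A)"] by simp
  then have "liminf (\<lambda>N. ereal (real (card A) / real N)) = 0"
    by (metis lim_imp_Liminf sequentially_bot zero_ereal_def)
  moreover have "lower_density A \<le> liminf (\<lambda>N. ereal (real (card A) / real N))"
    unfolding lower_density_def
    using \<open>finite A\<close> by (intro Liminf_mono always_eventually allI)
      (auto intro!: divide_right_mono card_mono)
  ultimately show False using assms by simp
qed

text \<open>A power of \<open>R\<close> need not be surjective, so the preimage of \<open>U\<close>
  is seen to be nonempty through a visit of the orbit to \<open>U\<close> at some time
  \<open>n \<ge> m\<close>.\<close>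

lemma frequently_hypercyclic_vector_shift:
  fixes R :: "'b::banach \<Rightarrow>\<^sub>L 'b"
  assumes "frequently_hypercyclic_vector R y"
  shows "frequently_hypercyclic_vector R ((blinfun_apply R ^^ m) y)"
  unfolding frequently_hypercyclic_vector_def
proof (intro allI impI, elim conjE)
  fix U :: "'b set" assume U: "open U" "U \<noteq> {}"
  then have "lower_density {n. (blinfun_apply R ^^ n) y \<in> U} > 0"
    using assms by (simp add: frequently_hypercyclic_vector_def)
  then have "infinite {n. (blinfun_apply R ^^ n) y \<in> U}"
    by (rule positive_lower_density_imp_infinite)
  then obtain n where n: "m \<le> n" "(blinfun_apply R ^^ n) y \<in> U"
    by (metis (mono_tags) infinite_nat_iff_unbounded_le mem_Collect_eq)
  let ?V = "(blinfun_apply R ^^ m) -` U"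
  have "(blinfun_apply R ^^ m) ((blinfun_apply R ^^ (n - m)) y) = (blinfun_apply R ^^ n) y"
    using n by (metis comp_apply funpow_add le_add_diff_inverse)
  then have "?V \<noteq> {}" using n by (metis empty_iff vimageI)
  moreover have "open ?V"
    by (intro open_vimage U linear_continuous_on bounded_linear_blinfun_power)
  ultimately have "lower_density {n. (blinfun_apply R ^^ n) y \<in> ?V} > 0"
    using assms unfolding frequently_hypercyclic_vector_def by blast
  moreover have "(blinfun_apply R ^^ n) y \<in> ?V \<longleftrightarrow>
      (blinfun_apply R ^^ n) ((blinfun_apply R ^^ m) y) \<in> U" for n
    by (metis add.commute comp_apply funpow_add vimage_eq)
  ultimately show "lower_density {n. (blinfun_apply R ^^ n) ((blinfun_apply R ^^ m) y) \<in> U} > 0"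
    by simp
qed

lemma frequently_hypercyclic_vector_orbit_dense:
  assumes "frequently_hypercyclic_vector R y" "closed C" "\<And>n. (blinfun_apply R ^^ n) y \<in> C"
  shows "C = UNIV"
proof (rule ccontr)
  assume "C \<noteq> UNIV"
  then have "open (- C)" "- C \<noteq> {}" using assms(2) by auto
  then have "lower_density {n. (blinfun_apply R ^^ n) y \<in> - C} > 0"
    using assms(1) unfolding frequently_hypercyclic_vector_def by blast
  moreover have "{n. (blinfun_apply R ^^ n) y \<in> - C} = {}" using assms(3) by auto
  ultimately show False using positive_lower_density_imp_infinite by fastforce
qed

text \<open>The topology is pulled back from the product topology on functions, where a basic open
  box restricts only finitely many coordinates; these form \<open>F\<close>.\<close>

lemma strong_operator_neighbourhood:
  assumes "openin strong_operator_topology W" "A \<in> W"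
  obtains F e where "finite F" "e > 0"
    "\<And>S. (\<And>x. x \<in> F \<Longrightarrow> norm (blinfun_apply S x - blinfun_apply A x) < e) \<Longrightarrow> S \<in> W"
proof -
  obtain V where V: "open V" "W = blinfun_apply -` V"
    using assms(1) by (auto simp: strong_operator_topology_def openin_pullback_topology)
  obtain X where X: "blinfun_apply A \<in> (\<Pi>\<^sub>E i\<in>UNIV. X i)" "\<And>i. open (X i)"
    "finite {i. X i \<noteq> UNIV}" "(\<Pi>\<^sub>E i\<in>UNIV. X i) \<subseteq> V"
    using product_topology_open_contains_basis[of "\<lambda>i. euclidean" UNIV V "blinfun_apply A"]
      V assms(2) by (auto simp: open_fun_def)
  let ?F = "{i. X i \<noteq> UNIV}"
  have "\<exists>e>0. ball (blinfun_apply A i) e \<subseteq> X i" for i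
    using X(1,2) by (auto simp: PiE_iff intro: openE)
  then obtain r where r: "\<And>i. r i > 0" "\<And>i. ball (blinfun_apply A i) (r i) \<subseteq> X i"
    by metis
  \<comment> \<open>The inserted \<open>1\<close> keeps the minimum defined when no coordinate is
    restricted.\<close>
  define e where "e = Min (insert 1 (r ` ?F))"
  have e: "e > 0" "\<And>i. i \<in> ?F \<Longrightarrow> e \<le> r i"
    using X(3) r(1) by (auto simp: e_def)
  show thesis
  proof (rule that[OF X(3) e(1)])
    fix S assume S: "\<And>x. x \<in> ?F \<Longrightarrow> norm (blinfun_apply S x - blinfun_apply A x) < e"
    have "blinfun_apply S i \<in> X i" for i
    proof (cases "i \<in> ?F")
      case True
      then have "blinfun_apply S i \<in> ball (blinfun_apply A i) (r i)"
        using S[OF True] e(2)[OF True] by (simp add: dist_norm norm_minus_commute)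
      then show ?thesis using r(2) by blast
    qed simp
    then show "S \<in> W" using X(4) by (auto simp: V(2) PiE_iff)
  qed
qed

section \<open>Perturbation of independent sets and failure of the d-Hypercyclicity
  Criterion\<close>

context banach_space_over
begin

lemma bounded_operator_blinfun: "T \<in> bounded_operators scl \<longleftrightarrow> bounded_operator (blinfun_apply T)"
  by (auto simp: bounded_operators_def bounded_operator_def blinfun.bounded_linear_right)

lemma bounded_operator_compose:
  "bounded_operator f \<Longrightarrow> bounded_operator g \<Longrightarrow> bounded_operator (\<lambda>x. f (g x))"
  by (auto simp: bounded_operator_def intro: bounded_linear_compose)

lemma bounded_operator_funpow: "bounded_operator f \<Longrightarrow> bounded_operator (f ^^ n)"
proof (induction n)
  case 0
  show ?case unfolding bounded_operator_def by (simp only: funpow.simps id_def bounded_linear_ident) simp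
next
  case (Suc n)
  then show ?case using bounded_operator_compose[of f "f ^^ n"] by (simp add: comp_def)
qed

lemma bounded_operator_sum:
  assumes "\<And>i. i \<in> I \<Longrightarrow> bounded_operator (f i)"
  shows "bounded_operator (\<lambda>x. \<Sum>i\<in>I. f i x)"
  using assms unfolding bounded_operator_def
  by (auto intro: bounded_linear_sum simp: scale_sum_right)

lemma bounded_operator_rank_one:
  assumes "bounded_functional g" shows "bounded_operator (\<lambda>x. scl (g x) v)"
  using assms bounded_linear_compose[OF bounded_bilinear.bounded_linear_left[OF bounded_bilinear_scl]]
  unfolding bounded_operator_def bounded_functional_def by auto

lemma independent_stable:
  assumes B: "finite B" "independent B"
  obtains e where "e > 0"
    "\<And>h. (\<And>b. b \<in> B \<Longrightarrow> norm (h b - b) < e) \<Longrightarrow> inj_on h B \<and> independent (h ` B)"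
proof -
  have "\<exists>g. bounded_functional g \<and> g b = 1 \<and> (\<forall>c\<in>B - {b}. g c = 0)" if "b \<in> B" for b
  proof -
    have "b \<notin> span (B - {b})" using B(2) that by (auto simp: dependent_def)
    then obtain g where g: "bounded_functional g" "\<And>x. x \<in> span (B - {b}) \<Longrightarrow> g x = 0" "g b \<noteq> 0"
      using Hahn_Banach_functional[OF subspace_span closed_span_finite[of "B - {b}"]] B(1) by blast
    have "bounded_functional (\<lambda>x. g x / g b)"
      using g(1) unfolding bounded_functional_def
      by (auto intro: bounded_linear_compose[OF bounded_linear_divide])
    then show ?thesis using g span_base by (intro exI[of _ "\<lambda>x. g x / g b"]) auto
  qed
  then obtain g where g: "\<And>b. b \<in> B \<Longrightarrow> bounded_functional (g b)" "\<And>b. b \<in> B \<Longrightarrow> g b b = 1"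
    "\<And>b c. b \<in> B \<Longrightarrow> c \<in> B \<Longrightarrow> c \<noteq> b \<Longrightarrow> g b c = 0"
    by (metis DiffI singletonD)
  have "\<exists>K\<ge>0. \<forall>x. norm (g b x) \<le> norm x * K" if "b \<in> B" for b
    using g(1)[OF that] bounded_linear.nonneg_bounded by (auto simp: bounded_functional_def)
  then obtain K where K: "\<And>b. b \<in> B \<Longrightarrow> K b \<ge> 0" "\<And>b x. b \<in> B \<Longrightarrow> norm (g b x) \<le> norm x * K b"
    by metis
  \<comment> \<open>This makes \<open>sum K B * e < 1\<close>, so \<open>P x\<close> is strictly
    shorter than \<open>x\<close> unless \<open>x = 0\<close>.\<close>
  define e where "e = 1 / (1 + sum K B)"
  have K0: "sum K B \<ge> 0" using K(1) by (rule sum_nonneg)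
  then have e0: "e > 0" by (simp add: e_def)
  show thesis
  proof (rule that[OF e0])
    fix h assume h: "\<And>b. b \<in> B \<Longrightarrow> norm (h b - b) < e"
    define P where "P = (\<lambda>x. \<Sum>b\<in>B. scl (g b x) (h b - b))"
    define F where "F = (\<lambda>x. x + P x)"
    have Pop: "bounded_operator P"
      unfolding P_def using g(1) by (intro bounded_operator_sum bounded_operator_rank_one)
    then have Fop: "bounded_operator F"
      unfolding F_def bounded_operator_def
      by (auto intro: bounded_linear_add bounded_linear_ident simp: scale_right_distrib)
    have Fb: "F b = h b" if "b \<in> B" for b
    proof -
      have "P b = (\<Sum>c\<in>B. if c = b then h b - b else 0)"
        unfolding P_def using g that by (intro sum.cong) auto
      then show ?thesis using B(1) that by (simp add: F_def)
    qed
    have zero: "x = 0" if "F x = 0" for x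
    proof -
      have "P x = - x" using that by (simp add: F_def eq_neg_iff_add_eq_0 add.commute)
      then have "norm x = norm (P x)" by simp
      also have "\<dots> \<le> (\<Sum>b\<in>B. norm (g b x) * norm (h b - b))"
        unfolding P_def by (rule order_trans[OF norm_sum]) (simp add: norm_scale)
      also have "\<dots> \<le> (\<Sum>b\<in>B. norm x * K b * e)"
        using K h by (intro sum_mono mult_mono) (auto intro: less_imp_le)
      also have "\<dots> = norm x * (sum K B * e)" by (simp add: sum_distrib_left sum_distrib_right mult.assoc)
      finally have "norm x * (1 - sum K B * e) \<le> 0" by (simp add: algebra_simps)
      moreover have "sum K B * e < 1" using K0 by (simp add: e_def)
      ultimately show "x = 0"
        by (metis diff_gt_0_iff_gt mult_le_0_iff norm_le_zero_iff not_less)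
    qed
    interpret vector_space_pair scl scl ..
    have lin: "Vector_Spaces.linear scl scl F" by (rule bounded_operator_linear[OF Fop])
    have inj: "inj F" using zero by (simp add: linear_inj_iff_eq_0[OF lin])
    have "independent (F ` B)"
      using linear_independent_injective_image[OF lin B(2)] inj by (meson inj_on_subset subset_UNIV)
    moreover have "F ` B = h ` B" using Fb by (rule image_cong[OF refl])
    moreover have "inj_on h B" using inj Fb by (metis inj_onI injD)
    ultimately show "inj_on h B \<and> independent (h ` B)" by simp
  qed
qed

text \<open>The span of a finite set is closed and proper, so it cannot contain a dense set; an
  independent subset can always be enlarged by one vector.\<close>

lemma dense_set_independent:
  assumes inf: "infinite_dimensional scl" and D: "closure D = UNIV"
  shows "\<exists>B\<subseteq>D. finite B \<and> card B = n \<and> independent B"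
proof (induction n)
  case 0
  then show ?case by (intro exI[of _ "{}"]) (auto simp: independent_empty)
next
  case (Suc n)
  then obtain B where B: "B \<subseteq> D" "finite B" "card B = n" "independent B" by blast
  have "\<not> D \<subseteq> span B"
    using closure_minimal[OF _ closed_span_finite[OF B(2)], of D] D B(2) inf
    by (auto simp: infinite_dimensional_def)
  then obtain d where d: "d \<in> D" "d \<notin> span B" by blast
  moreover have "d \<notin> B" using d(2) span_base by blast
  ultimately show ?case
    using B by (intro exI[of _ "insert d B"]) (simp add: independent_insertI)
qed

text \<open>If \<open>w\<close> runs through vectors with \<open>T\<^sup>n w\<close> close to \<open>b\<close> and \<open>T\<^sup>n L w\<close> close to \<open>0\<close>, then
  \<open>T\<^sup>n (w - L w)\<close> is close to \<open>b\<close>, yet stays in a space whose dimension is bounded by the rank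
  of \<open>L - I\<close>. So only boundedly many independent vectors \<open>b\<close> can be reached simultaneously.\<close>

lemma finite_rank_conjugate_not_criterion:
  assumes inf: "infinite_dimensional scl" and T: "T \<in> bounded_operators scl"
    and L: "finite_rank_perturbation L M" and S: "\<And>x. blinfun_apply S x = M (blinfun_apply T (L x))"
  shows "\<not> d_hypercyclicity_criterion [T, S]"
proof
  let ?T = "blinfun_apply T" and ?S = "blinfun_apply S"
  assume "d_hypercyclicity_criterion [T, S]"
  then obtain n :: "nat \<Rightarrow> nat" and X and Q :: "nat \<Rightarrow> nat \<Rightarrow> 'a \<Rightarrow> 'a" where
    X: "\<forall>m\<in>{0..length [T, S]}. closure (X m) = UNIV" and
    Q: "\<forall>m\<in>{1..length [T, S]}. \<forall>i\<in>{1..length [T, S]}. \<forall>x\<in>X i.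
        (\<lambda>k. (blinfun_apply ([T, S] ! (m - 1)) ^^ n k) (Q i k x) - (if i = m then x else 0))
          \<longlonglongrightarrow> 0"
    unfolding d_hypercyclicity_criterion_def by blast
  have X1: "closure (X 1) = UNIV" using X by simp
  \<comment> \<open>Condition (iii) with \<open>i = 1\<close>: for \<open>m = 1\<close> the
    Kronecker delta is 1, for \<open>m = 2\<close> it is 0.\<close>
  have QT: "(\<lambda>k. (?T ^^ n k) (Q 1 k x) - x) \<longlonglongrightarrow> 0" if "x \<in> X 1" for x
    using Q[rule_format, of 1 1 x] that by simp
  have QS: "(\<lambda>k. (?S ^^ n k) (Q 1 k x)) \<longlonglongrightarrow> 0" if "x \<in> X 1" for x
    using Q[rule_format, of 2 1 x] that by simp
  obtain G where G: "finite G" "\<And>x. L x - x \<in> span G"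
    and Lop: "bounded_operator L" and LM: "\<And>x. L (M x) = x"
    using L by (auto simp: finite_rank_perturbation_def)
  interpret L: bounded_linear L using Lop by (simp add: bounded_operator_def)
  \<comment> \<open>\<open>L\<close> intertwines the powers of \<open>S\<close> and
    \<open>T\<close>, and its continuity turns the limit for \<open>S\<close> into one for
    \<open>T\<close>.\<close>
  have "L ((?S ^^ n) x) = (?T ^^ n) (L x)" for n x
    by (induction n) (simp_all add: S LM)
  then have QL: "(\<lambda>k. (?T ^^ n k) (L (Q 1 k x))) \<longlonglongrightarrow> 0" if "x \<in> X 1" for x
    using L.tendsto[OF QS[OF that]] by (simp add: L.zero)
  \<comment> \<open>One vector more than \<open>G\<close> has: the approximants \<open>h k b\<close>
    will lie in the span of the image of \<open>G\<close> under a power of \<open>T\<close>.\<close>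
  obtain B where B: "B \<subseteq> X 1" "finite B" "card B = Suc (card G)" "independent B"
    using dense_set_independent[OF inf X1] by blast
  obtain e where e: "e > 0"
    "\<And>h. (\<And>b. b \<in> B \<Longrightarrow> norm (h b - b) < e) \<Longrightarrow> inj_on h B \<and> independent (h ` B)"
    using independent_stable[OF B(2,4)] by blast
  define h where "h = (\<lambda>k b. (?T ^^ n k) (Q 1 k b) - (?T ^^ n k) (L (Q 1 k b)))"
  have "(\<lambda>k. h k b - b) \<longlonglongrightarrow> 0" if "b \<in> B" for b
    using tendsto_diff[OF QT QL, of b b] that B(1) by (auto simp: h_def algebra_simps)
  then have "\<forall>\<^sub>F k in sequentially. norm (h k b - b) < e" if "b \<in> B" for b
    using tendstoD[OF _ e(1)] that by fastforce
  then have "\<forall>\<^sub>F k in sequentially. \<forall>b\<in>B. norm (h k b - b) < e"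
    using B(2) by (simp add: eventually_ball_finite)
  then obtain k where "\<forall>b\<in>B. norm (h k b - b) < e"
    using eventually_happens'[OF sequentially_bot] by blast
  then have ind: "inj_on (h k) B" "independent (h k ` B)" using e(2)[of "h k"] by blast+
  have top: "bounded_operator (?T ^^ n k)"
    using T by (simp add: bounded_operator_blinfun bounded_operator_funpow)
  then interpret Tn: bounded_linear "?T ^^ n k" by (simp add: bounded_operator_def)
  have "h k b \<in> span ((?T ^^ n k) ` G)" for b
  proof -
    have "Q 1 k b - L (Q 1 k b) \<in> span G"
      using G(2)[of "Q 1 k b"] span_neg by (metis minus_diff_eq)
    then have "(?T ^^ n k) (Q 1 k b - L (Q 1 k b)) \<in> span ((?T ^^ n k) ` G)"
      by (simp add: bounded_operator_span_image[OF top])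
    then show ?thesis by (simp add: h_def Tn.diff)
  qed
  then have "card (h k ` B) \<le> card ((?T ^^ n k) ` G)"
    using independent_span_bound[OF _ ind(2), of "(?T ^^ n k) ` G"] G(1) by blast
  also have "\<dots> \<le> card G" using G(1) by (rule card_image_le)
  finally show False using card_image[OF ind(1)] B(3) by simp
qed

section \<open>Approximation on finite sets\<close>

text \<open>A proper subspace contains no ball: if \<open>x\<close> lies in the current span, adding
  a small multiple of an outside vector moves it out. The set \<open>C\<close> collects vectors that
  must stay independent of the new ones.\<close>

lemma independent_approximation:
  assumes inf: "infinite_dimensional scl" and C: "finite C" "independent C" and e: "e > 0"
  shows "\<exists>ys. list_all2 (\<lambda>y x. norm (y - x) < e) ys xs \<and> distinct ys \<and> set ys \<inter> C = {} \<and>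
    independent (C \<union> set ys)"
proof (induction xs)
  case Nil
  then show ?case using C by simp
next
  case (Cons x xs)
  then obtain ys where ys: "list_all2 (\<lambda>y x. norm (y - x) < e) ys xs" "distinct ys"
    "set ys \<inter> C = {}" "independent (C \<union> set ys)" by blast
  let ?V = "span (C \<union> set ys)"
  have "\<exists>y. norm (y - x) < e \<and> y \<notin> ?V"
  proof (cases "x \<in> ?V")
    case True
    obtain w where w: "w \<notin> ?V"
      using inf C(1) unfolding infinite_dimensional_def by (metis UNIV_eq_I finite_Un finite_set)
    define t where "t = e / (1 + norm w)"
    have "1 + norm w > 0" by (simp add: add_pos_nonneg)
    then have t: "t > 0" "t * norm w < e" using e by (simp_all add: t_def field_simps)
    have "x + scl (of_real t) w \<notin> ?V"
    proof
      assume "x + scl (of_real t) w \<in> ?V"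
      then have "scl (of_real t) w \<in> ?V" using True span_add_eq by blast
      then have "scl (of_real (1 / t)) (scl (of_real t) w) \<in> ?V" by (rule span_scale)
      then show False using w t by (simp flip: of_real_mult)
    qed
    then show ?thesis using t by (intro exI[of _ "x + scl (of_real t) w"]) (simp add: norm_scale)
  qed (auto intro!: exI[of _ x] simp: e)
  then obtain y where y: "norm (y - x) < e" "y \<notin> ?V" by blast
  then have "y \<notin> C \<union> set ys" using span_base by blast
  moreover have "independent (C \<union> set (y # ys))"
    using independent_insertI[OF y(2) ys(4)] by simp
  ultimately show ?case using ys y by (intro exI[of _ "y # ys"]) simp
qed

text \<open>Expanding \<open>x\<close> in \<open>B\<close> bounds the error at \<open>x\<close> by
  the errors on \<open>B\<close> weighted with the coefficients. Approximation on a finite set thus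
  reduces to a basis of its span.\<close>

lemma operator_close_on_span:
  assumes "finite B" "e > 0" "x \<in> span B" "bounded_operator A"
  shows "\<exists>d>0. \<forall>S. bounded_operator S \<longrightarrow> (\<forall>b\<in>B. norm (S b - A b) < d) \<longrightarrow> norm (S x - A x) < e"
proof -
  obtain c where x: "x = (\<Sum>b\<in>B. scl (c b) b)"
    using assms(1,3) by (auto simp: span_finite)
  have apply_x: "S x = (\<Sum>b\<in>B. scl (c b) (S b))" if "bounded_operator S" for S
  proof -
    interpret S: bounded_linear S using that by (simp add: bounded_operator_def)
    show ?thesis using that by (simp add: x S.sum bounded_operator_def)
  qed
  define d where "d = e / (1 + (\<Sum>b\<in>B. norm (c b)))"
  have pos: "1 + (\<Sum>b\<in>B. norm (c b)) > 0" by (intro add_pos_nonneg sum_nonneg) auto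
  have "norm (S x - A x) < e" if S: "bounded_operator S" "\<forall>b\<in>B. norm (S b - A b) < d" for S
  proof -
    have "S x - A x = (\<Sum>b\<in>B. scl (c b) (S b - A b))"
      by (simp add: apply_x S(1) assms(4) scale_right_diff_distrib sum_subtractf)
    also have "norm \<dots> \<le> (\<Sum>b\<in>B. norm (c b) * norm (S b - A b))"
      by (rule order_trans[OF norm_sum]) (simp add: norm_scale)
    also have "\<dots> \<le> (\<Sum>b\<in>B. norm (c b) * d)"
      using S(2) by (intro sum_mono mult_left_mono) (auto intro: less_imp_le)
    also have "\<dots> = (\<Sum>b\<in>B. norm (c b)) * d" by (simp add: sum_distrib_right)
    also have "\<dots> < e" using pos assms(2) by (simp add: d_def field_simps)
    finally show ?thesis .
  qed
  moreover have "d > 0" using pos assms(2) by (simp add: d_def)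
  ultimately show ?thesis by blast
qed

subsection \<open>Orbits of frequently hypercyclic pairs\<close>

text \<open>Otherwise the orbit of the pair would stay in \<open>span B \<times> UNIV\<close>, which
  is closed and, in infinite dimension, proper.\<close>

lemma hypercyclic_orbit_leaves_span:
  assumes inf: "infinite_dimensional scl"
    and fhv: "frequently_hypercyclic_vector (direct_sum T S) (u, v)" and "finite B"
  shows "\<exists>n. (blinfun_apply T ^^ n) u \<notin> span B"
proof (rule ccontr)
  assume "\<not> ?thesis"
  then have "(blinfun_apply (direct_sum T S) ^^ n) (u, v) \<in> span B \<times> UNIV" for n
    by (simp add: direct_sum_power)
  moreover have "closed (span B \<times> (UNIV :: 'a set))"
    by (intro closed_Times closed_span_finite assms) auto
  ultimately have "span B \<times> (UNIV :: 'a set) = UNIV"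
    using frequently_hypercyclic_vector_orbit_dense[OF fhv] by blast
  then have "span B = UNIV" by (metis UNIV_I UNIV_eq_I mem_Sigma_iff)
  then show False using inf assms(3) by (auto simp: infinite_dimensional_def)
qed

text \<open>If \<open>orb N\<close> lay in the span of its predecessors, that span would be
  invariant under \<open>T\<close> and contain the whole orbit, although it is
  finite-dimensional.\<close>

lemma hypercyclic_orbit_independent:
  assumes inf: "infinite_dimensional scl" and T: "T \<in> bounded_operators scl"
    and fhv: "frequently_hypercyclic_vector (direct_sum T S) (u, v)"
  defines "orb \<equiv> \<lambda>n. (blinfun_apply T ^^ n) u"
  shows "inj orb" "independent (orb ` {..<N})"
proof -
  have new: "orb N \<notin> span (orb ` {..<N})" for N
  proof
    let ?V = "span (orb ` {..<N})"
    assume N: "orb N \<in> ?V"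
    have "blinfun_apply T ` orb ` {..<N} \<subseteq> ?V"
    proof (clarify)
      fix i assume "i < N"
      then have "orb (Suc i) \<in> ?V"
        using N by (cases "Suc i = N") (auto intro: span_base)
      then show "blinfun_apply T (orb i) \<in> ?V" by (simp add: orb_def)
    qed
    then have inv: "blinfun_apply T x \<in> ?V" if "x \<in> ?V" for x
      using bounded_operator_span_image[of "blinfun_apply T" "orb ` {..<N}"] T that
      by (metis bounded_operator_blinfun image_eqI span_minimal subsetD subspace_span)
    have "orb n \<in> ?V" for n
    proof (induction n)
      case 0
      \<comment> \<open>For \<open>N = 0\<close> the vector \<open>orb 0\<close> is
        \<open>orb N\<close> itself, covered by the assumption; otherwise it is a generator.\<close>
      show ?case using N by (cases "N = 0") (auto intro: span_base)
    next
      case (Suc n)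
      then show ?case using inv by (simp add: orb_def)
    qed
    then show False
      using hypercyclic_orbit_leaves_span[OF inf fhv, of "orb ` {..<N}"] by (auto simp: orb_def)
  qed
  show "inj orb"
  proof (rule linorder_injI)
    fix i j :: nat assume "i < j"
    then show "orb i \<noteq> orb j" using new[of j] by (metis imageI lessThan_iff span_base)
  qed
  show "independent (orb ` {..<N})"
    by (induction N) (simp_all add: lessThan_Suc independent_empty independent_insertI new)
qed

text \<open>Every element of the span of the orbit of \<open>u\<close> is \<open>P u\<close> for some continuous \<open>P\<close> that
  commutes with \<open>T\<close>, and \<open>(u, P u)\<close> never leaves the graph of \<open>P\<close>.\<close>

lemma hypercyclic_pair_notin_orbit_span:
  assumes inf: "infinite_dimensional scl" and T: "T \<in> bounded_operators scl"
    and fhv: "frequently_hypercyclic_vector (direct_sum T T) (u, v)"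
  shows "v \<notin> span (range (\<lambda>n. (blinfun_apply T ^^ n) u))"
proof
  let ?T = "blinfun_apply T"
  let ?C = "{P u | P. continuous_on UNIV P \<and> (\<forall>x. P (?T x) = ?T (P x))}"
  have T_scl: "?T (scl c x) = scl c (?T x)" for c x
    using T by (simp add: bounded_operators_def)
  have "subspace ?C"
    unfolding subspace_def
  proof (intro conjI ballI allI)
    show "0 \<in> ?C" by (rule CollectI, rule exI[of _ "\<lambda>x. 0"]) simp
  next
    fix x y assume "x \<in> ?C" "y \<in> ?C"
    then obtain P Q where "x = P u" "continuous_on UNIV P" "\<forall>x. P (?T x) = ?T (P x)"
      "y = Q u" "continuous_on UNIV Q" "\<forall>x. Q (?T x) = ?T (Q x)" by blast
    then show "x + y \<in> ?C"
      by (intro CollectI exI[of _ "\<lambda>x. P x + Q x"]) (simp add: continuous_on_add blinfun.add_right)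
  next
    fix c x assume "x \<in> ?C"
    then obtain P where "x = P u" "continuous_on UNIV P" "\<forall>x. P (?T x) = ?T (P x)" by blast
    then show "scl c x \<in> ?C"
      by (intro CollectI exI[of _ "\<lambda>x. scl c (P x)"])
        (simp add: T_scl bounded_linear.continuous_on[OF bounded_linear_scl_right])
  qed
  moreover have "(?T ^^ n) u \<in> ?C" for n
    by (rule CollectI, rule exI[of _ "?T ^^ n"])
      (simp add: linear_continuous_on bounded_linear_blinfun_power funpow_swap1)
  ultimately have "span (range (\<lambda>n. (?T ^^ n) u)) \<subseteq> ?C" by (intro span_minimal) auto
  moreover assume "v \<in> span (range (\<lambda>n. (?T ^^ n) u))"
  ultimately obtain P where v: "v = P u" and P: "continuous_on UNIV P" "\<And>x. P (?T x) = ?T (P x)"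
    by blast
  have "(?T ^^ n) v = P ((?T ^^ n) u)" for n
    by (induction n) (simp_all add: v P(2))
  then have "(blinfun_apply (direct_sum T T) ^^ n) (u, v) \<in> {z. snd z = P (fst z)}" for n
    by (simp add: direct_sum_power)
  moreover have "closed {z. snd z = P (fst z)}"
    by (intro closed_Collect_eq continuous_intros continuous_on_compose2[OF P(1)]) auto
  ultimately have graph: "{z. snd z = P (fst z)} = UNIV"
    using frequently_hypercyclic_vector_orbit_dense[OF fhv] by blast
  \<comment> \<open>The point \<open>(0, x)\<close> lies on the graph for every \<open>x\<close>, so
    the space is a single point.\<close>
  have "x = P 0" for x
    using graph by (metis (mono_tags) UNIV_I fst_conv mem_Collect_eq snd_conv)
  then have "(UNIV :: 'a set) \<subseteq> span {}" by (metis UNIV_I span_zero subsetI)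
  then show False using inf unfolding infinite_dimensional_def by (metis finite.emptyI top.extremum_uniqueI)
qed

lemma finite_rank_conjugate_d_frequently_hypercyclic:
  assumes fhv: "frequently_hypercyclic_vector (direct_sum T T) (u, L u)"
    and L: "finite_rank_perturbation L M" and S: "\<And>x. blinfun_apply S x = M (blinfun_apply T (L x))"
  shows "d_frequently_hypercyclic T S"
  unfolding d_frequently_hypercyclic_def frequently_hypercyclic_vector_def
proof (intro exI[of _ u] allI impI, elim conjE)
  fix U :: "('a \<times> 'a) set" assume U: "open U" "U \<noteq> {}"
  have LM: "\<And>x. L (M x) = x" and inv: "\<And>x. M (L x) = x" and M: "bounded_linear M"
    using L by (auto simp: finite_rank_perturbation_def bounded_operator_def)
  let ?h = "\<lambda>z. (fst z, M (snd z))"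
  have "open (?h -` U)"
    by (intro open_vimage U continuous_intros linear_continuous_on bounded_linear_compose[OF M]
        bounded_linear_snd)
  moreover obtain a b where "(a, b) \<in> U" using U(2) by auto
  then have "(a, L b) \<in> ?h -` U" by (simp add: inv)
  ultimately have "lower_density {n. (blinfun_apply (direct_sum T T) ^^ n) (u, L u) \<in> ?h -` U} > 0"
    using fhv unfolding frequently_hypercyclic_vector_def by blast
  moreover have "(blinfun_apply S ^^ n) x = M ((blinfun_apply T ^^ n) (L x))" for n x
    by (induction n) (simp_all add: S LM inv)
  ultimately show "lower_density {n. (blinfun_apply (direct_sum T S) ^^ n) (u, u) \<in> U} > 0"
    by (simp add: direct_sum_power)
qed

text \<open>Approximation on a basis \<open>b\<^sub>j\<close> of the span of \<open>F\<close>: \<open>L\<close> maps \<open>b\<^sub>j\<close> to \<open>T\<^sup>2\<^sup>j u\<close> and a vector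
  \<open>y\<^sub>j\<close> near \<open>A b\<^sub>j\<close> to \<open>T (T\<^sup>2\<^sup>j u)\<close>, so that \<open>L\<^sup>-\<^sup>1 T L\<close> maps \<open>b\<^sub>j\<close> to \<open>y\<^sub>j\<close>.\<close>

lemma approximation_by_finite_rank_conjugate:
  assumes inf: "infinite_dimensional scl" and T: "T \<in> bounded_operators scl"
    and fhc: "frequently_hypercyclic (direct_sum T T)"
    and A: "A \<in> bounded_operators scl" and F: "finite F" and e: "e > 0"
  obtains L M u where "finite_rank_perturbation L M"
    "frequently_hypercyclic_vector (direct_sum T T) (u, L u)"
    "\<And>x. x \<in> F \<Longrightarrow> norm (M (blinfun_apply T (L x)) - blinfun_apply A x) < e"
proof -
  let ?T = "blinfun_apply T"
  have Aop: "bounded_operator (blinfun_apply A)" and Top: "bounded_operator ?T"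
    using A T by (simp_all add: bounded_operator_blinfun)
  obtain B where B: "B \<subseteq> F" "independent B" "F \<subseteq> span B"
    by (rule maximal_independent_subset)
  have finB: "finite B" using B(1) F by (rule finite_subset)
  have "\<forall>x\<in>F. \<exists>d>0. \<forall>S. bounded_operator S \<longrightarrow> (\<forall>b\<in>B. norm (S b - blinfun_apply A b) < d) \<longrightarrow>
      norm (S x - blinfun_apply A x) < e"
    using operator_close_on_span[OF finB e _ Aop] B(3) by blast
  then obtain r where r: "\<And>x. x \<in> F \<Longrightarrow> r x > 0" "\<And>x S. x \<in> F \<Longrightarrow> bounded_operator S \<Longrightarrow>
      (\<And>b. b \<in> B \<Longrightarrow> norm (S b - blinfun_apply A b) < r x) \<Longrightarrow> norm (S x - blinfun_apply A x) < e"
    by metis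
  \<comment> \<open>One tolerance on \<open>B\<close> that works for all of
    \<open>F\<close>.\<close>
  define d where "d = Min (insert 1 (r ` F))"
  have d: "d > 0" "\<And>x. x \<in> F \<Longrightarrow> d \<le> r x"
    using F r(1) by (auto simp: d_def)
  obtain u0 v0 where uv0: "frequently_hypercyclic_vector (direct_sum T T) (u0, v0)"
    using fhc unfolding frequently_hypercyclic_def by auto
  \<comment> \<open>Shifting the pair along its orbit moves the first component out of
    \<open>span B\<close>, so that \<open>u\<close> and \<open>B\<close> can be source vectors
    together.\<close>
  obtain m where m: "(?T ^^ m) u0 \<notin> span B"
    using hypercyclic_orbit_leaves_span[OF inf uv0 finB] by blast
  define u v where "u = (?T ^^ m) u0" and "v = (?T ^^ m) v0"
  have uv: "frequently_hypercyclic_vector (direct_sum T T) (u, v)"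
    using frequently_hypercyclic_vector_shift[OF uv0, of m] by (simp add: u_def v_def direct_sum_power)
  define orb where "orb = (\<lambda>n. (?T ^^ n) u)"
  have orb: "inj orb" "\<And>N. independent (orb ` {..<N})"
    using hypercyclic_orbit_independent[OF inf T uv] by (simp_all add: orb_def)
  have v_orb: "v \<notin> span (range orb)"
    using hypercyclic_pair_notin_orbit_span[OF inf T uv] by (simp add: orb_def)
  obtain bl where bl: "set bl = B" "distinct bl" using finite_distinct_list[OF finB] by blast
  define k where "k = length bl"
  have uB: "u \<notin> span B" "u \<notin> B" using m span_base by (auto simp: u_def)
  \<comment> \<open>The values of \<open>A\<close> on \<open>B\<close> may be dependent;
    interpolation needs nearby vectors independent of each other, of \<open>u\<close> and of
    \<open>B\<close>.\<close>
  obtain ys where ys: "list_all2 (\<lambda>y x. norm (y - x) < d) ys (map (blinfun_apply A) bl)" "distinct ys"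
    "set ys \<inter> insert u B = {}" "independent (insert u B \<union> set ys)"
    using independent_approximation[OF inf _ independent_insertI[OF uB(1) B(2)] d(1)] finB by blast
  have len: "length ys = k" using list_all2_lengthD[OF ys(1)] by (simp add: k_def)
  define src where "src = u # bl @ ys"
  \<comment> \<open>Splitting into even and odd indices keeps all targets distinct; consecutive
    indices would collide.\<close>
  define ns where "ns = map (\<lambda>j. 2 * j) [0..<k] @ map (\<lambda>j. Suc (2 * j)) [0..<k]"
  \<comment> \<open>The head \<open>v\<close> is the target of \<open>u\<close>, which yields
    \<open>L u = v\<close>; by \<open>v_orb\<close> it is independent of the orbit vectors.\<close>
  define tgt where "tgt = v # map orb ns"
  have "distinct ns"
    by (auto simp: ns_def distinct_map inj_on_def; presburger)
  have ns_less: "set ns \<subseteq> {..<2 * k}" by (auto simp: ns_def)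
  have "length src = length tgt" by (simp add: src_def tgt_def ns_def len k_def)
  moreover have "distinct src" using ys(2,3) bl uB by (auto simp: src_def)
  moreover have "distinct tgt"
    using \<open>distinct ns\<close> orb(1) v_orb span_base
    by (auto simp: tgt_def distinct_map inj_on_def)
  moreover have "independent (set src)" using ys(4) bl by (simp add: src_def)
  moreover have "independent (set tgt)"
  proof -
    have "independent (orb ` set ns)"
      using independent_mono[OF orb(2)[of "2 * k"]] ns_less by blast
    moreover have "v \<notin> span (orb ` set ns)"
      using v_orb span_mono[of "orb ` set ns" "range orb"] by blast
    ultimately show ?thesis by (simp add: tgt_def independent_insertI)
  qed
  ultimately obtain L M where L: "finite_rank_perturbation L M" and map_L: "map L src = tgt"
    using finite_rank_perturbation_interpolation by blast
  have "L u = v" and "map L bl @ map L ys = map orb ns"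
    using map_L by (simp_all add: src_def tgt_def)
  then have map_bl: "map L bl = map orb (map (\<lambda>j. 2 * j) [0..<k])"
    and map_ys: "map L ys = map orb (map (\<lambda>j. Suc (2 * j)) [0..<k])"
    by (simp_all add: ns_def k_def append_eq_append_conv)
  have L_nth: "L (bl ! j) = orb (2 * j)" "L (ys ! j) = orb (Suc (2 * j))" if "j < k" for j
    using arg_cong[OF map_bl, of "\<lambda>zs. zs ! j"] arg_cong[OF map_ys, of "\<lambda>zs. zs ! j"] that len k_def
    by simp_all
  have conj: "bounded_operator (\<lambda>x. M (?T (L x)))" and inv: "\<And>x. M (L x) = x"
    using L Top by (auto simp: finite_rank_perturbation_def intro!: bounded_operator_compose[of M]
        bounded_operator_compose[of ?T])
  have close: "norm (M (?T (L b)) - blinfun_apply A b) < d" if b: "b \<in> B" for b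
  proof -
    obtain j where j: "j < k" "b = bl ! j"
      using b bl(1) by (metis in_set_conv_nth k_def)
    have "?T (L b) = orb (Suc (2 * j))" using j L_nth(1) by (simp add: orb_def)
    also have "\<dots> = L (ys ! j)" using j L_nth(2) by simp
    finally have "M (?T (L b)) = ys ! j" by (simp add: inv)
    then show ?thesis using list_all2_nthD2[OF ys(1), of j] j by (simp add: k_def)
  qed
  show thesis
  proof (rule that[OF L])
    show "frequently_hypercyclic_vector (direct_sum T T) (u, L u)" using uv \<open>L u = v\<close> by simp
    fix x assume "x \<in> F"
    then show "norm (M (?T (L x)) - blinfun_apply A x) < e"
      using r(2)[OF _ conj] close d(2) by (meson less_le_trans)
  qed
qed

end

section \<open>Density in the strong operator topology\<close>

theorem theorem2p5:
  fixes scl :: "'k::real_or_complex_field \<Rightarrow> 'a::banach \<Rightarrow> 'a"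
    and T :: "'a \<Rightarrow>\<^sub>L 'a"
  assumes "banach_space_over scl"
    and "separable_space (euclidean :: 'a topology)"
    and "infinite_dimensional scl"
    and "T \<in> bounded_operators scl"
    and "frequently_hypercyclic (direct_sum T T)"
  shows "subtopology strong_operator_topology (bounded_operators scl) closure_of
      {S \<in> bounded_operators scl.
        d_frequently_hypercyclic T S \<and> \<not> d_hypercyclicity_criterion [T, S]}
    = bounded_operators scl"
proof -
  interpret banach_space_over scl by fact
  let ?D = "{S \<in> bounded_operators scl.
        d_frequently_hypercyclic T S \<and> \<not> d_hypercyclicity_criterion [T, S]}"
  have top: "topspace (subtopology strong_operator_topology (bounded_operators scl)) = bounded_operators scl"
    by (simp add: strong_operator_topology_topspace)
  have "\<exists>S\<in>?D. S \<in> W"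
    if A: "A \<in> bounded_operators scl" "A \<in> W" and W: "openin strong_operator_topology W" for A W
  proof -
    obtain F e where Fe: "finite F" "e > 0"
      "\<And>S. (\<And>x. x \<in> F \<Longrightarrow> norm (blinfun_apply S x - blinfun_apply A x) < e) \<Longrightarrow> S \<in> W"
      using strong_operator_neighbourhood[OF W A(2)] by blast
    obtain L M u where L: "finite_rank_perturbation L M"
      and u: "frequently_hypercyclic_vector (direct_sum T T) (u, L u)"
      and close: "\<And>x. x \<in> F \<Longrightarrow> norm (M (blinfun_apply T (L x)) - blinfun_apply A x) < e"
      using approximation_by_finite_rank_conjugate[OF assms(3-5) A(1) Fe(1,2)] by blast
    define S where "S = Blinfun (\<lambda>x. M (blinfun_apply T (L x)))"
    have conj: "bounded_operator (\<lambda>x. M (blinfun_apply T (L x)))"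
      using L assms(4) unfolding finite_rank_perturbation_def bounded_operator_blinfun
      by (auto intro!: bounded_operator_compose[of M] bounded_operator_compose[of "blinfun_apply T"])
    then have S: "blinfun_apply S x = M (blinfun_apply T (L x))" for x
      by (simp add: S_def bounded_operator_def bounded_linear_Blinfun_apply)
    then have "blinfun_apply S = (\<lambda>x. M (blinfun_apply T (L x)))" by (rule ext)
    then have "S \<in> bounded_operators scl" using conj by (simp add: bounded_operator_blinfun)
    moreover have "d_frequently_hypercyclic T S"
      by (rule finite_rank_conjugate_d_frequently_hypercyclic[OF u L S])
    moreover have "\<not> d_hypercyclicity_criterion [T, S]"
      by (rule finite_rank_conjugate_not_criterion[OF assms(3,4) L S])
    moreover have "S \<in> W" by (rule Fe(3)) (simp add: S close)
    ultimately show ?thesis by blast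
  qed
  then have "bounded_operators scl \<subseteq>
      subtopology strong_operator_topology (bounded_operators scl) closure_of ?D"
    unfolding subset_iff in_closure_of top openin_subtopology by blast
  then show ?thesis
    using closure_of_subset_topspace[of "subtopology strong_operator_topology (bounded_operators scl)" ?D]
    unfolding top by blast
qed

end
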